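(* Let $n\ge3$, let $(f,\Gamma)$ be a normalized admissible pair with $f$ concave on $\Gamma$, and suppose $\mu_\Gamma^+\le1$. Let $\{w^{(a)}\}_{a\ge0}$ be the one-parameter family of solutions, described in the context, to $$\begin{cases} f(\lambda(-A_w))=\tfrac12,\quad \lambda(-A_w)\in\Gamma & \text{in }\mathbb{R}^n_+,\\ w=0 & \text{on }\partial\mathbb{R}^n_+.\end{cases}\qquad( * )$$ Then for all $0<\varepsilon<\mathcal{E}$, $$\inf_{t\in[\varepsilon,\mathcal{E}]}w^{(a)}(t)\to+\infty\quad\text{and}\quad\inf_{t\in[\varepsilon,\mathcal{E}]}(w^{(a)})'(t)\to+\infty\quad\text{as }a\to\infty.$$
   Context: $\mathbb{R}^n_+=\{x\in\mathbb{R}^n:x_n>0\}$. For a positive $C^2$ function $w$, $g_w=w^{-2}|dx|^2$ and $A_w=w\nabla^2w-\frac12|\nabla w|^2I$ (Euclidean derivatives); $\lambda(-A_w)$ is the vector of eigenvalues of $-A_w$. A normalized admissible pair $(f,\Gamma)$ means: $\Gamma\subset\mathbb{R}^n$ is an open, convex, connected, symmetric (permutation-invariant) cone with vertex at $0$; $\Gamma_n^+\subseteq\Gamma\subseteq\Gamma_1^+$, where $\Gamma_n^+=\{\lambda:\lambda_i>0\ \forall i\}$ and $\Gamma_1^+=\{\lambda:\sum_i\lambda_i>0\}$; $f\in C^\infty(\Gamma)\cap C^0(\overline\Gamma)$ is homogeneous of degree one and symmetric in the $\lambda_i$; $f>0$ in $\Gamma$, $f=0$ on $\partial\Gamma$,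 $\partial f/\partial\lambda_i>0$ in $\Gamma$ for each $i$; and $f(e)=1$ where $e=(1,\dots,1)$. $\mu_\Gamma^+\in[0,n-1]$ is the unique number with $(-\mu_\Gamma^+,1,\dots,1)\in\partial\Gamma$. The family $\{w^{(a)}\}_{a\ge0}$: smooth positive solutions of $( * )$ depending only on $x_n$ (so $w^{(a)}$ is regarded as a function of one variable $t=x_n$) such that (1) $w^{(0)}(x_n)=x_n$; (2) $w^{(a)}(1)=1+a$; (3) $(w^{(a)})'\ge1$ and $(w^{(a)})'(0)=1$; (4) $(w^{(a)})''\ge0$; (5) $0\le a<b$ implies $w^{(a)}(x_n)<w^{(b)}(x_n)$ for $x_n>0$; (6) $g_{w^{(a)}}$ is locally complete near $\partial\mathbb{R}^n_+$ for all $a\ge0$ but incomplete on $\mathbb{R}^n_+$ for $a>0$. Here locally complete near $\partial\mathbb{R}^n_+$ means: for every $x\in\partial\mathbb{R}^n_+$ and every neighbourhood $U$ of $x$ in $\overline{\mathbb{R}^n_+}$, any geodesic emanating from a point in $U$ which does not exit $U$ can be extended indefinitely. Such a family exists under the stated hypotheses. *)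

theory Defs
  imports "HOL-Analysis.Analysis"
begin

section \<open>Euclidean calculus\<close>

definition partial :: "'n::finite \<Rightarrow> (real^'n \<Rightarrow> real) \<Rightarrow> real^'n \<Rightarrow> real" where
  "partial i u x = frechet_derivative u (at x) (axis i 1)"

text \<open>Used for open sets \<open>U\<close> only.\<close>

primrec Ck_on :: "nat \<Rightarrow> (real^'n::finite) set \<Rightarrow> (real^'n \<Rightarrow> real) \<Rightarrow> bool" where
  "Ck_on 0 U u \<longleftrightarrow> continuous_on U u"
| "Ck_on (Suc m) U u \<longleftrightarrow> u differentiable_on U \<and> (\<forall>i. Ck_on m U (partial i u))"

definition smooth_on :: "(real^'n::finite) set \<Rightarrow> (real^'n \<Rightarrow> real) \<Rightarrow> bool" where
  "smooth_on U u \<longleftrightarrow> (\<forall>m. Ck_on m U u)"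

definition grad :: "(real^'n::finite \<Rightarrow> real) \<Rightarrow> real^'n \<Rightarrow> real^'n" where
  "grad u x = (\<chi> i. partial i u x)"

definition hessian :: "(real^'n::finite \<Rightarrow> real) \<Rightarrow> real^'n \<Rightarrow> real^'n^'n" where
  "hessian u x = (\<chi> i j. partial i (partial j u) x)"

definition A_mat :: "(real^'n::finite \<Rightarrow> real) \<Rightarrow> real^'n \<Rightarrow> real^'n^'n" where
  "A_mat u x = u x *\<^sub>R hessian u x - ((1/2) * (norm (grad u x))\<^sup>2) *\<^sub>R mat 1"

text \<open>The eigenvalues with algebraic multiplicity. They come in an unspecified order, so this
  is to be used only with permutation-invariant sets and functions.\<close>

definition eigenvalue_vec :: "real^'n^'n::finite \<Rightarrow> real^'n" where
  "eigenvalue_vec M = (SOME v. \<forall>x. det (mat x - M) = (\<Prod>i\<in>UNIV. x - v $ i))"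

section \<open>Admissible pairs\<close>

definition Gamma_pos :: "(real^'n::finite) set" where
  "Gamma_pos = {v. \<forall>i. v $ i > 0}"

definition Gamma_1 :: "(real^'n::finite) set" where
  "Gamma_1 = {v. (\<Sum>i\<in>UNIV. v $ i) > 0}"

definition permute_vec :: "('n \<Rightarrow> 'n) \<Rightarrow> real^'n::finite \<Rightarrow> real^'n" where
  "permute_vec p v = (\<chi> i. v $ p i)"

text \<open>The library's \<open>cone\<close> contains its vertex, which an open cone below \<open>Gamma_1\<close>
  cannot do; hence invariance under positive scalars.\<close>

definition admissible_cone :: "(real^'n::finite) set \<Rightarrow> bool" where
  "admissible_cone \<Gamma> \<longleftrightarrow>
     open \<Gamma> \<and> convex \<Gamma> \<and> connected \<Gamma> \<and>
     (\<forall>v\<in>\<Gamma>. \<forall>c>0. c *\<^sub>R v \<in> \<Gamma>) \<and>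
     (\<forall>v\<in>\<Gamma>. \<forall>p. bij p \<longrightarrow> permute_vec p v \<in> \<Gamma>) \<and>
     Gamma_pos \<subseteq> \<Gamma> \<and> \<Gamma> \<subseteq> Gamma_1"

definition normalized_admissible_pair ::
  "(real^'n::finite \<Rightarrow> real) \<Rightarrow> (real^'n) set \<Rightarrow> bool" where
  "normalized_admissible_pair f \<Gamma> \<longleftrightarrow>
     admissible_cone \<Gamma> \<and>
     smooth_on \<Gamma> f \<and> continuous_on (closure \<Gamma>) f \<and>
     (\<forall>v\<in>closure \<Gamma>. \<forall>c>0. f (c *\<^sub>R v) = c * f v) \<and>
     (\<forall>v\<in>closure \<Gamma>. \<forall>p. bij p \<longrightarrow> f (permute_vec p v) = f v) \<and>
     (\<forall>v\<in>\<Gamma>. f v > 0) \<and>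
     (\<forall>v\<in>frontier \<Gamma>. f v = 0) \<and>
     (\<forall>v\<in>\<Gamma>. \<forall>i. partial i f v > 0) \<and>
     f (\<chi> i. 1) = 1"

text \<open>By the symmetry of \<open>\<Gamma>\<close> the position \<open>j\<close> of the entry \<open>- m\<close> is irrelevant.\<close>

definition mu_plus :: "(real^'n::finite) set \<Rightarrow> real" where
  "mu_plus \<Gamma> = (THE m. 0 \<le> m \<and> m \<le> real CARD('n) - 1 \<and>
     (\<forall>j. (\<chi> i. if i = j then - m else 1) \<in> frontier \<Gamma>))"

section \<open>Geodesics\<close>

text \<open>A Riemannian metric on an open subset of Euclidean space is given by its Gram matrix
  \<open>g x\<close> at each point \<open>x\<close>.\<close>

definition christoffel ::
  "(real^'n::finite \<Rightarrow> real^'n^'n) \<Rightarrow> real^'n \<Rightarrow> 'n \<Rightarrow> 'n \<Rightarrow> 'n \<Rightarrow> real" where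
  "christoffel g x k i j = (1/2) * (\<Sum>l\<in>UNIV. matrix_inv (g x) $ k $ l *
     (partial i (\<lambda>y. g y $ j $ l) x + partial j (\<lambda>y. g y $ i $ l) x
      - partial l (\<lambda>y. g y $ i $ j) x))"

definition geodesic_on ::
  "(real^'n::finite \<Rightarrow> real^'n^'n) \<Rightarrow> (real^'n) set \<Rightarrow> real set \<Rightarrow> (real \<Rightarrow> real^'n) \<Rightarrow> bool" where
  "geodesic_on g \<Omega> J \<gamma> \<longleftrightarrow> (\<exists>v. \<forall>t\<in>J.
     \<gamma> t \<in> \<Omega> \<and>
     (\<gamma> has_vector_derivative v t) (at t within J) \<and>
     (v has_vector_derivative
        (\<chi> k. - (\<Sum>i\<in>UNIV. \<Sum>j\<in>UNIV. christoffel g (\<gamma> t) k i j * v t $ i * v t $ j)))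
       (at t within J))"

definition ray :: "ereal \<Rightarrow> real set" where
  "ray b = {t. 0 \<le> t \<and> ereal t < b}"

text \<open>A geodesic emanating from \<open>\<gamma> 0\<close> and extended forward as far as possible; it can be
  extended indefinitely iff \<open>b = \<infinity>\<close>.\<close>

definition maximal_geodesic ::
  "(real^'n::finite \<Rightarrow> real^'n^'n) \<Rightarrow> (real^'n) set \<Rightarrow> ereal \<Rightarrow> (real \<Rightarrow> real^'n) \<Rightarrow> bool" where
  "maximal_geodesic g \<Omega> b \<gamma> \<longleftrightarrow>
     0 < b \<and> geodesic_on g \<Omega> (ray b) \<gamma> \<and>
     \<not> (\<exists>c \<delta>. b < c \<and> geodesic_on g \<Omega> (ray c) \<delta> \<and> (\<forall>t\<in>ray b. \<delta> t = \<gamma> t))"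

definition complete_metric ::
  "(real^'n::finite \<Rightarrow> real^'n^'n) \<Rightarrow> (real^'n) set \<Rightarrow> bool" where
  "complete_metric g \<Omega> \<longleftrightarrow> (\<forall>b \<gamma>. maximal_geodesic g \<Omega> b \<gamma> \<longrightarrow> b = \<infinity>)"

text \<open>Two readings are built in. The neighbourhoods \<open>U\<close> are bounded: with
  \<open>U = closure \<Omega>\<close> allowed, local completeness would imply completeness. And the geodesics
  that do not exit \<open>U\<close> are maximal ones: a short piece of a geodesic inside \<open>U\<close> may
  well leave \<open>U\<close> when extended, and then fail to extend indefinitely.\<close>

definition locally_complete_near_boundary ::
  "(real^'n::finite \<Rightarrow> real^'n^'n) \<Rightarrow> (real^'n) set \<Rightarrow> bool" where
  "locally_complete_near_boundary g \<Omega> \<longleftrightarrow>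
     (\<forall>x\<in>frontier \<Omega>. \<forall>U.
        U \<subseteq> closure \<Omega> \<and> (\<exists>V. open V \<and> x \<in> V \<and> V \<inter> closure \<Omega> \<subseteq> U) \<and> bounded U \<longrightarrow>
        (\<forall>b \<gamma>. maximal_geodesic g \<Omega> b \<gamma> \<and> (\<forall>t\<in>ray b. \<gamma> t \<in> U) \<longrightarrow> b = \<infinity>))"

definition conf_metric :: "(real^'n::finite \<Rightarrow> real) \<Rightarrow> real^'n \<Rightarrow> real^'n^'n" where
  "conf_metric u x = mat (1 / (u x)\<^sup>2)"

section \<open>The equation on the half-space and the family of solutions\<close>

text \<open>The index \<open>k\<close> plays the role of the last coordinate.\<close>

definition half_space :: "'n::finite \<Rightarrow> (real^'n) set" where
  "half_space k = {x. x $ k > 0}"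

definition smooth_positive_solution ::
  "(real^'n::finite \<Rightarrow> real) \<Rightarrow> (real^'n) set \<Rightarrow> 'n \<Rightarrow> (real^'n \<Rightarrow> real) \<Rightarrow> bool" where
  "smooth_positive_solution f \<Gamma> k u \<longleftrightarrow>
     smooth_on (half_space k) u \<and> continuous_on (closure (half_space k)) u \<and>
     (\<forall>x\<in>half_space k. u x > 0) \<and>
     (\<forall>x\<in>half_space k. eigenvalue_vec (- A_mat u x) \<in> \<Gamma> \<and>
        f (eigenvalue_vec (- A_mat u x)) = 1/2) \<and>
     (\<forall>x\<in>frontier (half_space k). u x = 0)"

text \<open>\<open>w a\<close> is the profile of the solution \<open>\<lambda>x. w a (x $ k)\<close>; its values at negative
  arguments are irrelevant, so its derivative at \<open>0\<close> is one-sided.\<close>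

definition solution_family ::
  "(real^'n::finite \<Rightarrow> real) \<Rightarrow> (real^'n) set \<Rightarrow> 'n \<Rightarrow> (real \<Rightarrow> real \<Rightarrow> real) \<Rightarrow> bool" where
  "solution_family f \<Gamma> k w \<longleftrightarrow>
     (\<forall>a\<ge>0. smooth_positive_solution f \<Gamma> k (\<lambda>x. w a (x $ k))) \<and>
     (\<forall>t\<ge>0. w 0 t = t) \<and>
     (\<forall>a\<ge>0. w a 1 = 1 + a) \<and>
     (\<forall>a\<ge>0. (\<forall>t>0. deriv (w a) t \<ge> 1) \<and>
        (w a has_real_derivative 1) (at 0 within {0..})) \<and>
     (\<forall>a\<ge>0. \<forall>t>0. deriv (deriv (w a)) t \<ge> 0) \<and>
     (\<forall>a b t. 0 \<le> a \<and> a < b \<and> 0 < t \<longrightarrow> w a t < w b t) \<and>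
     (\<forall>a\<ge>0. locally_complete_near_boundary (conf_metric (\<lambda>x. w a (x $ k))) (half_space k)) \<and>
     (\<forall>a>0. \<not> complete_metric (conf_metric (\<lambda>x. w a (x $ k))) (half_space k))"

end

theory Submission
  imports Defs
begin

text \<open>The hypothesis \<open>mu_plus \<Gamma> \<le> 1\<close> makes every profile \<^emph>\<open>log-concave\<close>. For a function
  \<open>h\<close> of the coordinate \<open>x $ k\<close> alone, \<open>- A_mat\<close> is diagonal, with the entry
  \<open>h'\<^sup>2 / 2 - h h''\<close> at \<open>k\<close> and \<open>h'\<^sup>2 / 2\<close> elsewhere. Scaled by \<open>2 / h'\<^sup>2\<close>, the eigenvalue
  vector is \<open>(1, \<dots>, 1, s)\<close> with \<open>s = 1 - 2 h h'' / h'\<^sup>2\<close>. Such a vector lies in \<open>\<Gamma>\<close> only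
  if \<open>s > - mu_plus \<Gamma> \<ge> - 1\<close>, and \<open>s > - 1\<close> says \<open>h h'' < h'\<^sup>2\<close>, that is \<open>(ln h)'' < 0\<close>
  (\<open>profile_log_concave_inequality\<close>).

  The family is pinned down on both sides: \<open>w a 1 = 1 + a\<close> diverges, while \<open>w a \<delta> \<ge> w 0 \<delta> = \<delta>\<close>
  for all \<open>\<delta> > 0\<close>. If \<open>0 < \<delta> < s < 1\<close>, then \<open>ln (w a s)\<close> is at least the corresponding convex
  combination of \<open>ln \<delta>\<close> and \<open>ln (1 + a)\<close>, where the second weight is positive and does not
  depend on \<open>a\<close>; so \<open>w a s\<close> diverges (\<open>filterlim_log_concave_at_top\<close>). As \<open>w a\<close> is
  increasing, divergence spreads from \<open>s\<close> to all larger arguments. Finally \<open>w a\<close> is convex and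
  vanishes at \<open>0\<close>, so \<open>deriv (w a) t \<ge> w a t / t\<close>, and the slopes diverge too. Both \<open>w a\<close> and
  \<open>deriv (w a)\<close> are nondecreasing, so the two infima are values at \<open>\<epsilon>\<close>.\<close>

section \<open>Eigenvalues of a diagonal matrix\<close>

text \<open>The two products are values of real polynomials, which agree because they agree at every
  point; so they have the same roots with the same multiplicities.\<close>

lemma prod_linear_factors_eq_imp_permutation:
  fixes u v :: "'n::finite \<Rightarrow> real"
  assumes "\<And>x. (\<Prod>i\<in>UNIV. x - u i) = (\<Prod>i\<in>UNIV. x - v i)"
  obtains p where "bij p" "\<And>i. u i = v (p i)"
proof -
  have roots: "proots (\<Prod>i\<in>UNIV. [:- z i, 1:]) = image_mset z (mset_set UNIV)"
    for z :: "'n \<Rightarrow> real"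
  proof -
    have "proots (\<Prod>i\<in>UNIV. [:- z i, 1:]) = (\<Sum>i\<in>UNIV. {#z i#})"
      by (subst proots_prod) auto
    also have "\<dots> = image_mset z (\<Sum>i\<in>UNIV. {#i#})"
      by (induction rule: finite_induct[OF finite]) auto
    finally show ?thesis
      by simp
  qed
  have "poly (\<Prod>i\<in>UNIV. [:- u i, 1:]) = poly (\<Prod>i\<in>UNIV. [:- v i, 1:])"
    using assms by (simp add: poly_prod fun_eq_iff)
  then have "image_mset u (mset_set UNIV) = image_mset v (mset_set UNIV)"
    by (metis roots poly_eq_poly_eq_iff)
  then obtain p where "p permutes UNIV" "\<forall>i\<in>UNIV. u i = v (p i)"
    by (rule image_mset_eq_implies_permutes[rotated]) auto
  then show thesis
    by (intro that[of p]) (auto simp: permutes_bij)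
qed

text \<open>The vector chosen by \<open>eigenvalue_vec\<close> comes in an unknown order, so membership in a cone
  can be transferred to the diagonal only through a permutation, which the symmetry of the cone
  absorbs.\<close>

lemma eigenvalue_vec_diagonal:
  fixes d :: "'n::finite \<Rightarrow> real"
  obtains p where "bij p" "permute_vec p (eigenvalue_vec (\<chi> i j. if i = j then d i else 0)) = vec_lambda d"
proof -
  define M :: "real^'n^'n" where "M = (\<chi> i j. if i = j then d i else 0)"
  have det: "det (mat x - M) = (\<Prod>i\<in>UNIV. x - d i)" for x
    by (subst det_diagonal) (auto simp: M_def mat_def)
  have "\<forall>x. det (mat x - M) = (\<Prod>i\<in>UNIV. x - eigenvalue_vec M $ i)"
    unfolding eigenvalue_vec_def
    by (rule someI[where x = "vec_lambda d"]) (simp add: det)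
  then obtain p where "bij p" "\<And>i. d i = eigenvalue_vec M $ p i"
    using prod_linear_factors_eq_imp_permutation[of d "\<lambda>i. eigenvalue_vec M $ i"] det by metis
  then show thesis
    using that[of p] by (simp add: permute_vec_def vec_eq_iff M_def)
qed

section \<open>The meaning of \<open>mu_plus\<close>\<close>

definition ones_except :: "'n \<Rightarrow> real \<Rightarrow> real^'n::finite" where
  "ones_except j s = (\<chi> i. if i = j then s else 1)"

lemma continuous_on_ones_except [continuous_intros]:
  "continuous_on A (\<lambda>s. ones_except j s)"
  unfolding ones_except_def
proof (intro continuous_on_vec_lambda)
  show "continuous_on A (\<lambda>s. if i = j then s else 1 :: real)" for i
    by (cases "i = j") (auto intro: continuous_intros)
qed

lemma ones_except_mem_cone:
  assumes "admissible_cone \<Gamma>" "s > 0"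
  shows "ones_except j s \<in> \<Gamma>"
proof -
  have "ones_except j s \<in> Gamma_pos"
    using assms by (simp add: Gamma_pos_def ones_except_def)
  then show ?thesis
    using assms by (auto simp: admissible_cone_def)
qed

lemma sum_ones_except:
  "(\<Sum>i\<in>UNIV. ones_except (j::'n::finite) s $ i) = real CARD('n) - 1 + s"
proof -
  have "(\<Sum>i\<in>UNIV. ones_except j s $ i) = (\<Sum>i\<in>UNIV. 1 + (if i = j then s - 1 else 0))"
    by (intro sum.cong) (auto simp: ones_except_def)
  also have "\<dots> = real CARD('n) - 1 + s"
    by (simp add: sum.distrib)
  finally show ?thesis .
qed

text \<open>For \<open>s' \<le> 0\<close> the point \<open>ones_except j s'\<close> lies strictly between a point of the closure and
  the interior point \<open>(1, \<dots>, 1)\<close> of the convex set \<open>\<Gamma>\<close>, hence is interior itself. This makes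
  the line \<open>s \<mapsto> ones_except j s\<close> meet the frontier of \<open>\<Gamma>\<close> at most once.\<close>

lemma ones_except_closure_imp_mem:
  assumes "admissible_cone \<Gamma>" "ones_except j s \<in> closure \<Gamma>" "s < s'"
  shows "ones_except j s' \<in> \<Gamma>"
proof (cases "s' > 0")
  case True
  then show ?thesis
    using assms ones_except_mem_cone by blast
next
  case False
  \<comment> \<open>\<open>s'\<close> divides the segment from \<open>s\<close> to \<open>1\<close> in the ratio \<open>e : 1 - e\<close>\<close>
  define e where "e = (s' - s) / (1 - s)"
  have e: "0 < e" "e \<le> 1" "s - e * (s - 1) = s'"
    using assms False by (auto simp: e_def field_simps)
  have "convex \<Gamma>" "ones_except j 1 \<in> interior \<Gamma>"
    using assms ones_except_mem_cone[of \<Gamma> 1 j] by (auto simp: admissible_cone_def interior_open)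
  then have "ones_except j s - e *\<^sub>R (ones_except j s - ones_except j 1) \<in> interior \<Gamma>"
    using assms(2) e(1,2) by (intro mem_interior_closure_convex_shrink) auto
  also have "ones_except j s - e *\<^sub>R (ones_except j s - ones_except j 1) = ones_except j s'"
    using e(3) by (auto simp: ones_except_def vec_eq_iff)
  finally show ?thesis
    using interior_subset by blast
qed

lemma permute_vec_frontier:
  assumes cone: "admissible_cone \<Gamma>" and v: "v \<in> frontier \<Gamma>" and p: "bij p"
  shows "permute_vec p v \<in> frontier \<Gamma>"
proof -
  have "open \<Gamma>" and perm: "\<And>v p. v \<in> \<Gamma> \<Longrightarrow> bij p \<Longrightarrow> permute_vec p v \<in> \<Gamma>"
    using cone by (auto simp: admissible_cone_def)
  then have frontier: "frontier \<Gamma> = closure \<Gamma> - \<Gamma>"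
    by (simp add: frontier_def interior_open)
  have "continuous_on (closure \<Gamma>) (permute_vec p)"
    unfolding permute_vec_def by (intro continuous_intros)
  moreover have "permute_vec p ` \<Gamma> \<subseteq> closure \<Gamma>"
    using perm p closure_subset by blast
  ultimately have "permute_vec p ` closure \<Gamma> \<subseteq> closure \<Gamma>"
    by (intro image_closure_subset) auto
  then have "permute_vec p v \<in> closure \<Gamma>"
    using v frontier by auto
  moreover have "permute_vec p v \<notin> \<Gamma>"
  proof
    assume "permute_vec p v \<in> \<Gamma>"
    then have "permute_vec (inv p) (permute_vec p v) \<in> \<Gamma>"
      using perm p bij_imp_bij_inv by blast
    moreover have "permute_vec (inv p) (permute_vec p v) = v"
      using p by (simp add: permute_vec_def vec_eq_iff bij_is_surj surj_f_inv_f)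
    ultimately show False
      using v frontier by auto
  qed
  ultimately show ?thesis
    using frontier by blast
qed

lemma ones_except_frontier_unique:
  assumes cone: "admissible_cone \<Gamma>"
    and "ones_except j s \<in> frontier \<Gamma>" "ones_except j s' \<in> frontier \<Gamma>"
  shows "s = s'"
proof -
  have "frontier \<Gamma> = closure \<Gamma> - \<Gamma>"
    using cone by (simp add: admissible_cone_def frontier_def interior_open)
  then show ?thesis
    using assms ones_except_closure_imp_mem[OF cone] by (metis DiffD1 DiffD2 linorder_cases)
qed

text \<open>The number \<open>mu_plus \<Gamma>\<close> is a definite description, so the boundary point has to be shown to
  exist. On the line \<open>s \<mapsto> ones_except j s\<close>, the cone contains the point with \<open>s = 1\<close> but not
  the one with \<open>s = 1 - CARD('n)\<close>, whose entries add up to \<open>0\<close>; so the segment between them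
  crosses the frontier, and symmetry puts the crossing at the same parameter for every position
  \<open>j\<close>. By monotonicity in \<open>s\<close>, membership in the cone begins only past this parameter.\<close>

lemma ones_except_mem_cone_imp_gt:
  fixes \<Gamma> :: "(real^'n::finite) set"
  assumes cone: "admissible_cone \<Gamma>" and mem: "ones_except j s \<in> \<Gamma>"
  shows "s > - mu_plus \<Gamma>"
proof -
  let ?N = "real CARD('n) - 1"
  have N: "?N \<ge> 0"
    by (simp add: Suc_leI)
  have frontier: "frontier \<Gamma> = closure \<Gamma> - \<Gamma>"
    using cone by (simp add: admissible_cone_def frontier_def interior_open)
  have notin: "ones_except j (- ?N) \<notin> \<Gamma>"
  proof
    assume "ones_except j (- ?N) \<in> \<Gamma>"
    then have "ones_except j (- ?N) \<in> Gamma_1"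
      using cone by (auto simp: admissible_cone_def)
    then show False
      by (simp add: Gamma_1_def sum_ones_except)
  qed
  have "ones_except j ` {- ?N..1} \<inter> frontier \<Gamma> \<noteq> {}"
  proof (rule connected_Int_frontier)
    show "connected (ones_except j ` {- ?N..1})"
      by (intro connected_continuous_image continuous_intros) auto
    have "ones_except j 1 \<in> \<Gamma>" "1 \<in> {- ?N..1}"
      using ones_except_mem_cone[OF cone] N by auto
    then show "ones_except j ` {- ?N..1} \<inter> \<Gamma> \<noteq> {}"
      by blast
    have "- ?N \<in> {- ?N..1}"
      using N by simp
    then show "ones_except j ` {- ?N..1} - \<Gamma> \<noteq> {}"
      using notin by blast
  qed
  then obtain c where c: "- ?N \<le> c" "ones_except j c \<in> frontier \<Gamma>"
    by auto
  then have "c \<le> 0"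
    using ones_except_mem_cone[OF cone, of c j] frontier by fastforce
  have all: "ones_except i c \<in> frontier \<Gamma>" for i
  proof -
    have "permute_vec (Transposition.transpose i j) (ones_except j c) = ones_except i c"
      by (auto simp: permute_vec_def ones_except_def vec_eq_iff Transposition.transpose_def)
    then show ?thesis
      using permute_vec_frontier[OF cone c(2), of "Transposition.transpose i j"] by simp
  qed
  have "mu_plus \<Gamma> = - c"
    unfolding mu_plus_def ones_except_def[symmetric]
  proof (rule the_equality)
    show "0 \<le> - c \<and> - c \<le> ?N \<and> (\<forall>j. ones_except j (- (- c)) \<in> frontier \<Gamma>)"
      using c \<open>c \<le> 0\<close> all by auto
  next
    fix m assume "0 \<le> m \<and> m \<le> ?N \<and> (\<forall>j. ones_except j (- m) \<in> frontier \<Gamma>)"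
    then have "- m = c"
      using ones_except_frontier_unique[OF cone _ c(2)] by blast
    then show "m = - c"
      by simp
  qed
  moreover have "c < s"
  proof (rule ccontr)
    assume "\<not> c < s"
    then have "ones_except j c \<in> \<Gamma>"
      using mem ones_except_closure_imp_mem[OF cone, of j s c] closure_subset
      by (metis linorder_neqE_linordered_idom subsetD)
    then show False
      using c frontier by auto
  qed
  ultimately show ?thesis
    by simp
qed

section \<open>Functions of one coordinate\<close>

lemma has_derivative_of_coordinate:
  fixes k :: "'n::finite"
  assumes "(h has_real_derivative D) (at (x $ k))"
  shows "((\<lambda>x::real^'n. h (x $ k)) has_derivative (\<lambda>y. D * (y $ k))) (at x)"
proof -
  have "((\<lambda>x::real^'n. x $ k) has_derivative (\<lambda>y. y $ k)) (at x)"
    by (intro bounded_linear_imp_has_derivative bounded_linear_vec_nth)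
  then show ?thesis
    using assms by (auto simp: has_field_derivative_def intro: has_derivative_compose)
qed

lemma partial_of_coordinate:
  fixes k :: "'n::finite"
  assumes h: "(h has_real_derivative D) (at (x $ k))"
    and "open X" "x \<in> X" "\<And>y. y \<in> X \<Longrightarrow> u y = h (y $ k)"
  shows "partial i u (x::real^'n) = (if i = k then D else 0)"
proof -
  have "(u has_derivative (\<lambda>y. D * (y $ k))) (at x)"
    by (rule has_derivative_transform_within_open[OF has_derivative_of_coordinate[OF h] assms(2,3)])
      (simp add: assms(4))
  then have "frechet_derivative u (at x) = (\<lambda>y. D * (y $ k))"
    by (rule frechet_derivative_at[symmetric])
  then show ?thesis
    by (auto simp: partial_def axis_def)
qed

lemma open_half_space: "open (half_space k :: (real^'n::finite) set)"
  by (simp add: half_space_def open_halfspace_component_gt_cart)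

text \<open>Smoothness is assumed of functions on the half-space, whereas the argument needs it for the
  profile; restricting to the \<open>k\<close>-th coordinate axis recovers it.\<close>

lemma differentiable_of_coordinate_imp:
  fixes u :: "real^'n::finite \<Rightarrow> real"
  assumes diff: "u differentiable_on half_space k" and "t > 0"
    and eq: "\<And>y. y \<in> half_space k \<Longrightarrow> u y = h (y $ k)"
  shows "h differentiable at t"
proof -
  note open_half_space
  moreover have "axis k t \<in> half_space k"
    using \<open>t > 0\<close> by (simp add: half_space_def)
  ultimately have "u differentiable (at (axis k t))"
    using diff by (metis at_within_open differentiable_on_def)
  moreover have "(axis k :: real \<Rightarrow> real^'n) differentiable (at t)"
  proof -
    have "(\<lambda>s. s *\<^sub>R axis k 1 :: real^'n) differentiable (at t)"
      by (intro derivative_intros)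
    also have "(\<lambda>s. s *\<^sub>R axis k 1 :: real^'n) = axis k"
      by (auto simp: axis_def vec_eq_iff fun_eq_iff)
    finally show ?thesis .
  qed
  ultimately have "(\<lambda>s. u (axis k s)) differentiable (at t)"
    using differentiable_chain_at[of "axis k" t u] by (simp add: o_def)
  then obtain D where "((\<lambda>s. u (axis k s)) has_derivative D) (at t)"
    by (auto simp: differentiable_def)
  then have "(h has_derivative D) (at t)"
    by (rule has_derivative_transform_within_open[of _ _ _ _ "{0<..}"])
      (use \<open>t > 0\<close> eq in \<open>auto simp: half_space_def\<close>)
  then show ?thesis
    by (auto simp: differentiable_def)
qed

text \<open>The first partial derivative in direction \<open>k\<close> is again a function of \<open>x $ k\<close>, namely
  \<open>deriv h\<close>, so the restriction to the axis can be applied a second time.\<close>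

lemma smooth_of_coordinate_derivatives:
  fixes k :: "'n::finite"
  assumes smooth: "smooth_on (half_space k :: (real^'n) set) (\<lambda>x. h (x $ k))" and "t > 0"
  shows "(h has_real_derivative deriv h t) (at t)"
    and "(deriv h has_real_derivative deriv (deriv h) t) (at t)"
proof -
  let ?u = "\<lambda>x::real^'n. h (x $ k)"
  note open_hs = open_half_space[of k]
  have "Ck_on 2 (half_space k) ?u"
    using smooth by (simp add: smooth_on_def)
  then have C2: "?u differentiable_on half_space k" "partial k ?u differentiable_on half_space k"
    by (auto simp: numeral_2_eq_2)
  have d1: "(h has_real_derivative deriv h s) (at s)" if "s > 0" for s
    using differentiable_of_coordinate_imp[OF C2(1) that, of h]
    by (simp add: DERIV_deriv_iff_real_differentiable)
  show "(h has_real_derivative deriv h t) (at t)"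
    by (rule d1) fact
  have "partial k ?u y = deriv h (y $ k)" if "y \<in> half_space k" for y
    using partial_of_coordinate[OF d1 open_hs that, where u = ?u and i = k] that by (simp add: half_space_def)
  then have "deriv h differentiable at t"
    by (rule differentiable_of_coordinate_imp[OF C2(2) \<open>t > 0\<close>])
  then show "(deriv h has_real_derivative deriv (deriv h) t) (at t)"
    by (simp add: DERIV_deriv_iff_real_differentiable)
qed

lemma A_mat_of_coordinate:
  fixes k :: "'n::finite"
  assumes smooth: "smooth_on (half_space k :: (real^'n) set) (\<lambda>x. h (x $ k))"
    and x: "x \<in> half_space k"
  defines "t \<equiv> x $ k"
  shows "- A_mat (\<lambda>x. h (x $ k)) x =
    (\<chi> i j. if i = j then (deriv h t)\<^sup>2 / 2 - (if i = k then h t * deriv (deriv h) t else 0) else 0)"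
proof -
  let ?u = "\<lambda>x::real^'n. h (x $ k)"
  note open_hs = open_half_space[of k]
  have pos: "y $ k > 0" if "y \<in> half_space k" for y :: "real^'n"
    using that by (simp add: half_space_def)
  note derivs = smooth_of_coordinate_derivatives[OF smooth]
  have first: "partial j ?u y = (if j = k then deriv h (y $ k) else 0)" if "y \<in> half_space k" for j y
    using partial_of_coordinate[OF derivs(1) open_hs that, where u = ?u and i = j] pos[OF that] by simp
  have second: "partial i (partial j ?u) x = (if i = k \<and> j = k then deriv (deriv h) t else 0)" for i j
  proof (cases "j = k")
    case True
    then show ?thesis
      using partial_of_coordinate[OF derivs(2) open_hs x, where u = "partial j ?u" and i = i] pos[OF x] first
      by (simp add: t_def)
  next
    case False
    have "((\<lambda>_. 0 :: real) has_real_derivative 0) (at (x $ k))"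
      by simp
    then show ?thesis
      using partial_of_coordinate[OF _ open_hs x, where h = "\<lambda>_. 0" and D = 0 and u = "partial j ?u" and i = i] first False
      by auto
  qed
  have "grad ?u x = deriv h t *\<^sub>R axis k 1"
    using first[OF x] by (auto simp: grad_def vec_eq_iff axis_def t_def)
  then have "(norm (grad ?u x))\<^sup>2 = (deriv h t)\<^sup>2"
    by (simp add: power_mult_distrib)
  then show ?thesis
    by (auto simp: A_mat_def hessian_def second vec_eq_iff mat_def t_def)
qed

section \<open>Log-concavity of the profiles\<close>

text \<open>This is where \<open>mu_plus \<Gamma> \<le> 1\<close> enters: \<open>1 - 2 h h'' / h'\<^sup>2 > - mu_plus \<Gamma> \<ge> - 1\<close>.\<close>

lemma profile_log_concave_inequality:
  fixes k :: "'n::finite"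
  assumes cone: "admissible_cone \<Gamma>" and mu: "mu_plus \<Gamma> \<le> 1"
    and sol: "smooth_positive_solution f \<Gamma> k (\<lambda>x. h (x $ k))"
    and "t > 0" and slope: "deriv h t \<noteq> 0"
  shows "h t * deriv (deriv h) t < (deriv h t)\<^sup>2"
proof -
  define x :: "real^'n" where "x = axis k t"
  define d where "d i = (deriv h t)\<^sup>2 / 2 - (if i = k then h t * deriv (deriv h) t else 0)" for i
  \<comment> \<open>the factor that scales the \<open>n - 1\<close> equal eigenvalues to \<open>1\<close>\<close>
  define c where "c = 2 / (deriv h t)\<^sup>2"
  have c: "c > 0"
    using slope by (simp add: c_def)
  have x: "x \<in> half_space k" "x $ k = t"
    using \<open>t > 0\<close> by (auto simp: x_def half_space_def)
  define M :: "real^'n^'n" where "M = (\<chi> i j. if i = j then d i else 0)"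
  have "smooth_on (half_space k) (\<lambda>x::real^'n. h (x $ k))"
    using sol by (simp add: smooth_positive_solution_def)
  from A_mat_of_coordinate[OF this x(1)]
  have M: "- A_mat (\<lambda>x. h (x $ k)) x = M"
    unfolding x(2) M_def d_def .
  have ev: "eigenvalue_vec M \<in> \<Gamma>"
    using sol x(1) unfolding M[symmetric] by (simp add: smooth_positive_solution_def)
  obtain q where q: "bij q" "permute_vec q (eigenvalue_vec M) = vec_lambda d"
    unfolding M_def by (rule eigenvalue_vec_diagonal)
  have "permute_vec q (eigenvalue_vec M) \<in> \<Gamma>"
    using cone ev q(1) by (simp add: admissible_cone_def)
  then have "vec_lambda d \<in> \<Gamma>"
    by (simp only: q(2))
  then have "c *\<^sub>R vec_lambda d \<in> \<Gamma>"
    using cone c by (auto simp: admissible_cone_def)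
  also have "c *\<^sub>R vec_lambda d = ones_except k (1 - c * (h t * deriv (deriv h) t))"
    using slope by (auto simp: ones_except_def vec_eq_iff d_def c_def field_simps)
  finally have "- mu_plus \<Gamma> < 1 - c * (h t * deriv (deriv h) t)"
    by (rule ones_except_mem_cone_imp_gt[OF cone])
  with mu have "c * (h t * deriv (deriv h) t) < 2"
    by linarith
  then show ?thesis
    using slope by (simp add: c_def field_simps)
qed

lemma ln_concave_onI:
  fixes h :: "real \<Rightarrow> real"
  assumes "convex C" and pos: "\<And>t. t \<in> C \<Longrightarrow> h t > 0"
    and d1: "\<And>t. t \<in> C \<Longrightarrow> (h has_real_derivative h' t) (at t)"
    and d2: "\<And>t. t \<in> C \<Longrightarrow> (h' has_real_derivative h'' t) (at t)"
    and le: "\<And>t. t \<in> C \<Longrightarrow> h t * h'' t \<le> (h' t)\<^sup>2"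
  shows "concave_on C (\<lambda>t. ln (h t))"
proof (rule f''_le0_imp_concave[OF \<open>convex C\<close>])
  fix t assume t: "t \<in> C"
  show "((\<lambda>t. ln (h t)) has_real_derivative h' t / h t) (at t)"
    using pos[OF t] d1[OF t] by (auto intro!: derivative_eq_intros)
  show "((\<lambda>t. h' t / h t) has_real_derivative (h'' t * h t - h' t * h' t) / (h t * h t)) (at t)"
    using pos[OF t] by (intro DERIV_divide d1 d2 t) auto
  show "(h'' t * h t - h' t * h' t) / (h t * h t) \<le> 0"
    using le[OF t] by (intro divide_nonpos_nonneg) (auto simp: power2_eq_square mult.commute)
qed

text \<open>Log-concavity carries divergence at \<open>1\<close> back to \<open>s\<close>, since the values at \<open>\<delta>\<close> stay away
  from \<open>0\<close>: with \<open>s = (1 - \<theta>) \<delta> + \<theta>\<close>, \<open>w a s\<close> is bounded below by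
  \<open>\<delta> powr (1 - \<theta>) * w a 1 powr \<theta>\<close>.\<close>

lemma filterlim_log_concave_at_top:
  fixes w :: "real \<Rightarrow> real \<Rightarrow> real"
  assumes "0 < \<delta>" "\<delta> < s" "s < 1"
    and conc: "\<forall>\<^sub>F a in F. concave_on {\<delta>..1} (\<lambda>t. ln (w a t))"
    and pos: "\<forall>\<^sub>F a in F. w a s > 0"
    and low: "\<forall>\<^sub>F a in F. \<delta> \<le> w a \<delta>"
    and top: "filterlim (\<lambda>a. w a 1) at_top F"
  shows "filterlim (\<lambda>a. w a s) at_top F"
proof -
  define \<theta> where "\<theta> = (s - \<delta>) / (1 - \<delta>)"
  have \<theta>: "0 < \<theta>" "\<theta> < 1" "(1 - \<theta>) * \<delta> + \<theta> * 1 = s"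
  proof -
    have "\<theta> * (1 - \<delta>) = s - \<delta>"
      using assms(1-3) by (simp add: \<theta>_def)
    then show "(1 - \<theta>) * \<delta> + \<theta> * 1 = s"
      by (simp add: algebra_simps)
  qed (use assms(1-3) in \<open>simp_all add: \<theta>_def\<close>)
  have "filterlim (\<lambda>a. (1 - \<theta>) * ln \<delta> + \<theta> * ln (w a 1)) at_top F"
    by (intro filterlim_tendsto_add_at_top[OF tendsto_const]
        filterlim_tendsto_pos_mult_at_top[OF tendsto_const \<theta>(1)]
        filterlim_compose[OF ln_at_top] top)
  then have "filterlim (\<lambda>a. exp ((1 - \<theta>) * ln \<delta> + \<theta> * ln (w a 1))) at_top F"
    by (rule filterlim_compose[OF exp_at_top])
  moreover have "\<forall>\<^sub>F a in F. exp ((1 - \<theta>) * ln \<delta> + \<theta> * ln (w a 1)) \<le> w a s"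
    using conc pos low
  proof eventually_elim
    case (elim a)
    have "(1 - \<theta>) * ln \<delta> + \<theta> * ln (w a 1) \<le> (1 - \<theta>) * ln (w a \<delta>) + \<theta> * ln (w a 1)"
      using elim(3) \<theta> \<open>0 < \<delta>\<close> by (intro add_right_mono mult_left_mono) auto
    also have "\<dots> \<le> ln (w a ((1 - \<theta>) *\<^sub>R \<delta> + \<theta> *\<^sub>R 1))"
      using \<theta> assms(1-3) by (intro concave_onD[OF elim(1)]) auto
    also have "(1 - \<theta>) *\<^sub>R \<delta> + \<theta> *\<^sub>R 1 = s"
      using \<theta>(3) by simp
    finally show ?case
      using elim(2) by (metis exp_le_cancel_iff exp_ln)
  qed
  ultimately show ?thesis
    by (rule filterlim_at_top_mono)
qed

section \<open>Divergence of the family\<close>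

lemma zero_frontier_half_space: "0 \<in> frontier (half_space k :: (real^'n::finite) set)"
proof -
  have "closure (half_space k) = {x::real^'n. x $ k \<ge> 0}"
    by (simp add: half_space_def)
  moreover have "(0 :: real^'n) \<notin> half_space k"
    by (simp add: half_space_def)
  ultimately show ?thesis
    by (simp add: frontier_def interior_open open_half_space)
qed

lemma INF_eq_left_endpoint:
  fixes g :: "real \<Rightarrow> real"
  assumes "l \<le> r" "\<And>t. l \<le> t \<Longrightarrow> g l \<le> g t"
  shows "(INF t\<in>{l..r}. g t) = g l"
  by (rule cInf_eq_minimum) (use assms in auto)

theorem theorem1p5:
  fixes f :: "real^'n \<Rightarrow> real"
    and \<Gamma> :: "(real^'n) set"
    and k :: 'n
    and w :: "real \<Rightarrow> real \<Rightarrow> real"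
    and \<epsilon> E :: real
  assumes "CARD('n) \<ge> 3"
    and "normalized_admissible_pair f \<Gamma>"
    and "concave_on \<Gamma> f"
    and "mu_plus \<Gamma> \<le> 1"
    and "solution_family f \<Gamma> k w"
    and "0 < \<epsilon>" and "\<epsilon> < E"
  shows "filterlim (\<lambda>a. INF t\<in>{\<epsilon>..E}. w a t) at_top at_top \<and>
         filterlim (\<lambda>a. INF t\<in>{\<epsilon>..E}. deriv (w a) t) at_top at_top"
proof -
  have cone: "admissible_cone \<Gamma>"
    using assms(2) by (simp add: normalized_admissible_pair_def)
  have sol: "smooth_positive_solution f \<Gamma> k (\<lambda>x. w a (x $ k))"
    and w_1: "w a 1 = 1 + a"
    and deriv_0: "(w a has_real_derivative 1) (at 0 within {0..})" if "a \<ge> 0" for a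
    using assms(5) that by (auto simp: solution_family_def)
  have deriv_ge_1: "deriv (w a) t \<ge> 1" and deriv2_ge_0: "deriv (deriv (w a)) t \<ge> 0"
    if "a \<ge> 0" "t > 0" for a t
    using assms(5) that by (auto simp: solution_family_def)
  have d1: "(w a has_real_derivative deriv (w a) t) (at t)"
    and d2: "(deriv (w a) has_real_derivative deriv (deriv (w a)) t) (at t)"
    if "a \<ge> 0" "t > 0" for a t
    using smooth_of_coordinate_derivatives[of k "w a" t] sol that
    by (auto simp: smooth_positive_solution_def)
  have w_ge: "t \<le> w a t" if "a > 0" "t > 0" for a t
  proof -
    have "w 0 t = t"
      using assms(5) that by (simp add: solution_family_def)
    moreover have "\<forall>a b t. 0 \<le> a \<and> a < b \<and> 0 < t \<longrightarrow> w a t < w b t"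
      using assms(5) unfolding solution_family_def by (elim conjE)
    then have "w 0 t < w a t"
      using that by simp
    ultimately show ?thesis
      by simp
  qed
  have w_0: "w a 0 = 0" if "a \<ge> 0" for a
    using sol[OF that] zero_frontier_half_space[of k]
    by (auto simp: smooth_positive_solution_def)
  have w_mono: "w a s \<le> w a t" if "a \<ge> 0" "0 < s" "s \<le> t" for a s t
  proof (rule DERIV_nonneg_imp_nondecreasing[OF \<open>s \<le> t\<close>], intro exI conjI)
    fix x assume "s \<le> x"
    with that have "x > 0"
      by simp
    then show "(w a has_real_derivative deriv (w a) x) (at x)" "0 \<le> deriv (w a) x"
      using d1 deriv_ge_1[of a x] that(1) by simp_all
  qed
  have deriv_mono: "deriv (w a) s \<le> deriv (w a) t" if "a \<ge> 0" "0 < s" "s \<le> t" for a s t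
  proof (rule DERIV_nonneg_imp_nondecreasing[OF \<open>s \<le> t\<close>], intro exI conjI)
    fix x assume "s \<le> x"
    with that have "x > 0"
      by simp
    then show "(deriv (w a) has_real_derivative deriv (deriv (w a)) x) (at x)"
        "0 \<le> deriv (deriv (w a)) x"
      using d2 deriv2_ge_0 that(1) by simp_all
  qed
  have deriv_ge: "w a t / t \<le> deriv (w a) t" if a: "a \<ge> 0" and t: "t > 0" for a t
  proof -
    have "continuous (at s within {0..t}) (w a)" if "s \<in> {0..t}" for s
    proof (cases "s = 0")
      case True
      have "continuous (at 0 within {0..}) (w a)"
        using deriv_0[OF a] by (rule DERIV_continuous)
      then show ?thesis
        unfolding True by (rule continuous_within_subset) auto
    next
      case False
      then show ?thesis
        using that d1[OF a, of s] by (auto intro: DERIV_isCont continuous_at_imp_continuous_at_within)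
    qed
    then have "continuous_on {0..t} (w a)"
      by (simp add: continuous_on_eq_continuous_within)
    moreover have "w a differentiable (at s)" if "0 < s" "s < t" for s
      using d1[OF a that(1)] by (auto simp: real_differentiable_def)
    ultimately obtain l z where z: "0 < z" "z < t" "DERIV (w a) z :> l" "w a t - w a 0 = (t - 0) * l"
      using MVT[OF t, of "w a"] by blast
    then have "l = deriv (w a) z"
      using DERIV_unique d1[OF a z(1)] by blast
    then have "w a t / t = deriv (w a) z"
      using z(4) w_0[OF a] t by simp
    also have "\<dots> \<le> deriv (w a) t"
      using deriv_mono[OF a, of z t] z by simp
    finally show ?thesis .
  qed
  have log_concave: "concave_on {\<delta>..1} (\<lambda>t. ln (w a t))" if "a > 0" "\<delta> > 0" for a \<delta>
  proof (rule ln_concave_onI[where h' = "deriv (w a)" and h'' = "deriv (deriv (w a))"])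
    fix t assume "t \<in> {\<delta>..1}"
    with that have t: "t > 0"
      by simp
    show "w a t > 0"
      using w_ge[OF that(1) t] t by simp
    show "w a t * deriv (deriv (w a)) t \<le> (deriv (w a) t)\<^sup>2"
      using profile_log_concave_inequality[OF cone assms(4) sol t, of a] deriv_ge_1[of a t] that t
      by force
  qed (use that d1 d2 in auto)
  \<comment> \<open>\<open>\<epsilon>\<close> may exceed \<open>1\<close>, but the interpolation needs an argument strictly below \<open>1\<close>\<close>
  define s where "s = min \<epsilon> (1/2)"
  have s: "0 < s" "s < 1" "s \<le> \<epsilon>"
    using \<open>0 < \<epsilon>\<close> by (auto simp: s_def)
  have ev: "\<forall>\<^sub>F a in at_top. a > (0::real)"
    by (rule eventually_gt_at_top)
  have "filterlim (\<lambda>a::real. 1 + a) at_top at_top"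
    by (intro filterlim_tendsto_add_at_top[OF tendsto_const] filterlim_ident)
  then have "filterlim (\<lambda>a. w a 1) at_top at_top"
    by (rule filterlim_at_top_mono) (use ev in \<open>eventually_elim, simp add: w_1\<close>)
  then have "filterlim (\<lambda>a. w a s) at_top at_top"
  proof (rule filterlim_log_concave_at_top[of "s / 2", rotated -1])
    show "\<forall>\<^sub>F a in at_top. concave_on {s / 2..1} (\<lambda>t. ln (w a t))"
      using ev by eventually_elim (use log_concave s in simp)
    show "\<forall>\<^sub>F a in at_top. w a s > 0"
      using ev by eventually_elim (use w_ge s in force)
    show "\<forall>\<^sub>F a in at_top. s / 2 \<le> w a (s / 2)"
      using ev by eventually_elim (intro w_ge, use s in auto)
  qed (use s in auto)
  then have w_top: "filterlim (\<lambda>a. w a \<epsilon>) at_top at_top"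
    by (rule filterlim_at_top_mono) (use ev in \<open>eventually_elim, use w_mono s in simp\<close>)
  have "filterlim (\<lambda>a. w a \<epsilon> * (1 / \<epsilon>)) at_top at_top"
    by (rule filterlim_at_top_mult_tendsto_pos[OF tendsto_const _ w_top]) (use \<open>0 < \<epsilon>\<close> in simp)
  then have deriv_top: "filterlim (\<lambda>a. deriv (w a) \<epsilon>) at_top at_top"
    by (rule filterlim_at_top_mono)
      (use ev in \<open>eventually_elim, use deriv_ge \<open>0 < \<epsilon>\<close> in simp\<close>)
  have "\<forall>\<^sub>F a in at_top. (INF t\<in>{\<epsilon>..E}. w a t) = w a \<epsilon>"
    using ev by eventually_elim (use w_mono assms(6,7) in \<open>auto intro!: INF_eq_left_endpoint\<close>)
  moreover have "\<forall>\<^sub>F a in at_top. (INF t\<in>{\<epsilon>..E}. deriv (w a) t) = deriv (w a) \<epsilon>"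
    using ev by eventually_elim (use deriv_mono assms(6,7) in \<open>auto intro!: INF_eq_left_endpoint\<close>)
  ultimately show ?thesis
    using w_top deriv_top by (simp cong: filterlim_cong)
qed

end
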